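(* Assume that $F$ is convex-concave, that is, there exists $z$ such that $F''(x)\ge0$ for $x\le z$ and $F''(x)\le0$ for $x\ge z$. Then the wave speed $c$ is bounded in terms of the parameters of the system, $\sigma$ and $F$: $$\frac{\sigma}{\sqrt2\,(a_2-a_1)}\,\frac{\int_{a_1}^{a_2}(x-F(x))\,dx}{\sqrt{\int_{a_1}^{a}(x-F(x))\,dx}}\;\le\;c\;\le\;\frac{\sigma}{4}\,\frac{\int_{a_1}^{a_2}(x-F(x))\,dx}{\int_a^{a_2}(F(x)-x)\,dx}.$$
   Context: Neural field equation: $\partial_tu(x,t)=-u(x,t)+w*F(u(\cdot,t))(x)$, with kernel $w(x)=\frac1{2\sigma}e^{-|x|/\sigma}$ for some $\sigma>0$, where $w*h(x)=\int w(x-y)h(y)\,dy$. $F$ is a strictly increasing sigmoid function (twice differentiable) such that $-x+F(x)$ is bistable: there are exactly three zeros $a_1<a<a_2$ of $F(x)-x$, with $F'(a_i)<1$ for $i=1,2$ and $F'(a)>1$. $(\hat u,c)$ is a strictly monotone traveling wave solution connecting the stable states: $\hat u\in C^1(\mathbb{R})$, $\hat u_x>0$, $\lim_{x\to-\infty}\hat u(x)=a_1$, $\lim_{x\to\infty}\hat u(x)=a_2$, $c\in\mathbb{R}$ is the wave speed, and $-c\,\hat u_x=-\hat u+w*F(\hat u)$ (so $u(x,t)=\hat u(x-ct)$ solves the equation).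
   Formalization: The wave speed is additionally assumed to satisfy c ≥ 0; for c < 0 the displayed bounds can contradict each other (e.g. F(x)=1/(1+exp(-5(x-0.49))), σ=1), the correct ones then being obtained by reflection. *)

theory Defs
  imports "HOL-Analysis.Analysis"
begin

definition synaptic_kernel :: "real \<Rightarrow> real \<Rightarrow> real" where
  "synaptic_kernel \<sigma> x = 1 / (2 * \<sigma>) * exp (- \<bar>x\<bar> / \<sigma>)"

definition convolution :: "(real \<Rightarrow> real) \<Rightarrow> (real \<Rightarrow> real) \<Rightarrow> real \<Rightarrow> real" where
  "convolution w h x = (\<integral>y. w (x - y) * h y \<partial>lborel)"

text \<open>The sign pattern of the second derivative (the S-shape) is not part of the
  notion of sigmoid used here; it is the separate predicate \<open>convex_concave\<close>.
  Boundedness and strict monotonicity together give the two horizontal asymptotes.\<close>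

definition sigmoid :: "(real \<Rightarrow> real) \<Rightarrow> bool" where
  "sigmoid F \<longleftrightarrow> strict_mono F \<and> bounded (range F) \<and>
     (\<forall>x. F differentiable (at x)) \<and> (\<forall>x. deriv F differentiable (at x))"

definition bistable :: "(real \<Rightarrow> real) \<Rightarrow> real \<Rightarrow> real \<Rightarrow> real \<Rightarrow> bool" where
  "bistable F a1 a a2 \<longleftrightarrow> a1 < a \<and> a < a2 \<and> {x. F x - x = 0} = {a1, a, a2} \<and>
     deriv F a1 < 1 \<and> deriv F a2 < 1 \<and> deriv F a > 1"

definition convex_concave :: "(real \<Rightarrow> real) \<Rightarrow> bool" where
  "convex_concave F \<longleftrightarrow>
     (\<exists>z. (\<forall>x\<le>z. deriv (deriv F) x \<ge> 0) \<and> (\<forall>x\<ge>z. deriv (deriv F) x \<le> 0))"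

text \<open>The profile equation is what \<open>u(x,t) = v (x - c t)\<close> must satisfy in order to
  solve \<open>\<partial>\<^sub>t u = - u + w * F(u)\<close>.\<close>

definition monotone_traveling_wave ::
    "(real \<Rightarrow> real) \<Rightarrow> (real \<Rightarrow> real) \<Rightarrow> real \<Rightarrow> real \<Rightarrow> (real \<Rightarrow> real) \<Rightarrow> real \<Rightarrow> bool" where
  "monotone_traveling_wave w F a1 a2 v c \<longleftrightarrow>
     v C1_differentiable_on UNIV \<and> (\<forall>x. deriv v x > 0) \<and>
     (v \<longlongrightarrow> a1) at_bot \<and> (v \<longlongrightarrow> a2) at_top \<and>
     (\<forall>x. - c * deriv v x = - v x + convolution w (\<lambda>y. F (v y)) x)"

end

theory Submission
  imports Defs
begin

text \<open>The kernel is the Green's function of \<open>1 - \<sigma>\<^sup>2 d\<^sup>2/dx\<^sup>2\<close>, so the profile equation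
  \<open>v - c v' = w * F(v)\<close> turns into the third-order equation
  \<open>p - c p' = F(v)\<close> with \<open>p = v - \<sigma>\<^sup>2 v''\<close>, the function called \<open>source\<close> below. Let \<open>\<Phi>' = u - F u\<close>. By the signs of \<open>F u - u\<close>,
  the potential \<open>\<Phi>\<close> rises from \<open>a1\<close> to \<open>a\<close> and falls from \<open>a\<close> to \<open>a2\<close>, and the three integrals in the
  theorem are \<open>\<Phi> a2 - \<Phi> a1\<close>, \<open>\<Phi> a - \<Phi> a1\<close> and \<open>\<Phi> a - \<Phi> a2\<close>.

  For \<open>c > 0\<close> the equation exhibits \<open>p\<close> as an average of the increasing function \<open>F(v)\<close> over values to
  the right, so \<open>p \<ge> F(v)\<close> and \<open>p' \<ge> 0\<close>. Multiplying the equation by \<open>v'\<close>, the mechanical energy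
  \<open>\<Phi>(v) - \<sigma>\<^sup>2 v'\<^sup>2/2\<close> has derivative \<open>c v' p' \<ge> 0\<close>, and it runs from \<open>\<Phi> a1\<close> to \<open>\<Phi> a2\<close>. That
  monotonicity bounds the slope on both sides: \<open>\<sigma>\<^sup>2 v'\<^sup>2/2 \<le> \<Phi> a - \<Phi> a1\<close> everywhere, and
  \<open>\<sigma>\<^sup>2 v'\<^sup>2/2 \<ge> \<Phi> a - \<Phi> a2\<close> where \<open>v = a\<close>.

  Both speed bounds come from integrating the energy law over the line,
  \<open>\<Phi> a2 - \<Phi> a1 = c \<integral> v' p' = c \<integral> (v'\<^sup>2 + \<sigma>\<^sup>2 v''\<^sup>2)\<close>.
  The first integral is at most \<open>(a2 - a1) max v'\<close> because \<open>p\<close> increases from \<open>a1\<close> to \<open>a2\<close>;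
  with the upper slope bound this is the lower bound on \<open>c\<close> (\<open>energy_gap_le_max_slope\<close>).
  The second integral is at least \<open>\<sigma> \<integral> |(v'\<^sup>2)'|\<close>, which is at least \<open>2 \<sigma> v'(x)\<^sup>2\<close> for every \<open>x\<close>,
  since \<open>v'\<close> vanishes at both ends; with the lower slope bound this is the upper bound on \<open>c\<close>
  (\<open>energy_gap_ge_slope_squared\<close>). For \<open>c = 0\<close> the energy is constant, so \<open>\<Phi> a2 = \<Phi> a1\<close> and both
  bounds are \<open>0\<close>.\<close>

section \<open>Monotonicity from infinity\<close>

text \<open>This lemma and its mirror image replace integration over the whole line: an inequality between
  integrals becomes the sign of a derivative together with the limits of a primitive.\<close>

lemma le_limit_at_top:
  fixes g :: "real \<Rightarrow> real"
  assumes deriv: "\<And>x. (g has_real_derivative g' x) (at x)"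
    and nonneg: "\<And>x. g' x \<ge> 0"
    and lim: "(g \<longlongrightarrow> l) at_top"
  shows "g x \<le> l"
proof (rule tendsto_lowerbound[OF lim])
  show "\<forall>\<^sub>F y in at_top. g x \<le> g y"
    using eventually_ge_at_top[of x]
    by eventually_elim (metis DERIV_nonneg_imp_nondecreasing deriv nonneg)
qed simp

lemma limit_at_bot_le:
  fixes g :: "real \<Rightarrow> real"
  assumes deriv: "\<And>x. (g has_real_derivative g' x) (at x)"
    and nonneg: "\<And>x. g' x \<ge> 0"
    and lim: "(g \<longlongrightarrow> l) at_bot"
  shows "l \<le> g x"
proof (rule tendsto_upperbound[OF lim])
  show "\<forall>\<^sub>F y in at_bot. g y \<le> g x"
    using eventually_le_at_bot[of x]
    by eventually_elim (metis DERIV_nonneg_imp_nondecreasing deriv nonneg)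
qed simp

lemma exp_minus_divide_tendsto_0:
  fixes c :: real
  assumes "c > 0"
  shows "((\<lambda>x. exp (- x / c)) \<longlongrightarrow> 0) at_top"
proof (rule filterlim_compose[OF exp_at_bot])
  have "filterlim (\<lambda>x. (1/c) * x) at_top at_top"
    using assms by (intro filterlim_tendsto_pos_mult_at_top[OF tendsto_const _ filterlim_ident]) auto
  thus "filterlim (\<lambda>x. - x / c) at_bot at_top"
    by (simp add: filterlim_uminus_at_bot)
qed

section \<open>The exponential kernel as a Green's function\<close>

text \<open>The right half of twice the synaptic kernel, of total mass one. Splitting the kernel at its kink
  leaves two averages, each of which satisfies a first-order equation.\<close>

definition half_kernel :: "real \<Rightarrow> real \<Rightarrow> real" where
  "half_kernel \<sigma> u = indicator {0..} u * (exp (- u / \<sigma>) / \<sigma>)"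

definition right_average :: "real \<Rightarrow> (real \<Rightarrow> real) \<Rightarrow> real \<Rightarrow> real" where
  "right_average \<sigma> h x = (\<integral>u. half_kernel \<sigma> u * h (x + u) \<partial>lborel)"

lemma half_kernel_borel [measurable]: "half_kernel \<sigma> \<in> borel_measurable borel"
  unfolding half_kernel_def by measurable

lemma half_kernel_nonneg: "\<sigma> > 0 \<Longrightarrow> half_kernel \<sigma> u \<ge> 0"
  by (simp add: half_kernel_def)

lemma half_kernel_integral:
  assumes "\<sigma> > 0"
  shows "integrable lborel (half_kernel \<sigma>)" and "integral\<^sup>L lborel (half_kernel \<sigma>) = 1"
proof -
  have lim: "((\<lambda>x. - exp (- x / \<sigma>)) \<longlongrightarrow> 0) at_top"
    using tendsto_minus[OF exp_minus_divide_tendsto_0[OF assms]] by simp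
  have "(\<integral>\<^sup>+ x. ennreal (exp (- x / \<sigma>) / \<sigma>) * indicator {0..} x \<partial>lborel) = ennreal (0 - (- exp (- 0 / \<sigma>)))"
    by (rule nn_integral_FTC_atLeast[OF _ _ _ lim])
      (use assms in \<open>auto intro!: derivative_eq_intros simp: field_simps\<close>)
  moreover have "ennreal (half_kernel \<sigma> x) = ennreal (exp (- x / \<sigma>) / \<sigma>) * indicator {0..} x" for x
    by (auto simp: half_kernel_def indicator_def)
  ultimately have "(\<integral>\<^sup>+ x. ennreal (half_kernel \<sigma> x) \<partial>lborel) = ennreal 1" by simp
  hence "has_bochner_integral lborel (half_kernel \<sigma>) 1"
    using assms by (intro has_bochner_integral_nn_integral) (auto simp: half_kernel_nonneg)
  thus "integrable lborel (half_kernel \<sigma>)" "integral\<^sup>L lborel (half_kernel \<sigma>) = 1"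
    by (auto simp: has_bochner_integral_iff)
qed

lemma half_kernel_mult_integrable:
  assumes "\<sigma> > 0" and "continuous_on UNIV h" and "\<And>x. \<bar>h x\<bar> \<le> b"
  shows "integrable lborel (\<lambda>u. half_kernel \<sigma> u * h (x + u))"
proof (rule Bochner_Integration.integrable_bound)
  show "integrable lborel (\<lambda>u. half_kernel \<sigma> u * b)"
    using half_kernel_integral[OF assms(1)] by simp
  have [measurable]: "h \<in> borel_measurable borel"
    using assms(2) by (rule borel_measurable_continuous_onI)
  show "(\<lambda>u. half_kernel \<sigma> u * h (x + u)) \<in> borel_measurable lborel" by measurable
  show "AE u in lborel. norm (half_kernel \<sigma> u * h (x + u)) \<le> norm (half_kernel \<sigma> u * b)"
    by (intro AE_I2) (auto simp: abs_mult intro!: mult_left_mono order_trans[OF assms(3) abs_ge_self])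
qed

text \<open>Taking \<open>X t = t\<close> and \<open>X t = - t\<close> gives the limits at the two ends, because dominated
  convergence is at hand for parameters tending to \<open>at_top\<close>.\<close>

lemma right_average_tendsto_along:
  assumes "\<sigma> > 0" and "continuous_on UNIV h" and "\<And>x. \<bar>h x\<bar> \<le> b"
    and lim: "\<And>u. ((\<lambda>t. h (X t + u)) \<longlongrightarrow> l) (at_top :: real filter)"
  shows "((\<lambda>t. right_average \<sigma> h (X t)) \<longlongrightarrow> l) at_top"
proof -
  have [measurable]: "h \<in> borel_measurable borel"
    using assms(2) by (rule borel_measurable_continuous_onI)
  have "((\<lambda>t. \<integral>u. half_kernel \<sigma> u * h (X t + u) \<partial>lborel) \<longlongrightarrow> (\<integral>u. half_kernel \<sigma> u * l \<partial>lborel)) at_top"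
  proof (rule integral_dominated_convergence_at_top)
    show "integrable lborel (\<lambda>u. half_kernel \<sigma> u * b)"
      using half_kernel_integral[OF assms(1)] by simp
    show "\<forall>\<^sub>F t in at_top. AE u in lborel. norm (half_kernel \<sigma> u * h (X t + u)) \<le> half_kernel \<sigma> u * b"
      by (intro always_eventually allI AE_I2)
        (auto simp: abs_mult half_kernel_nonneg[OF assms(1)] intro!: mult_left_mono assms(3))
    show "AE u in lborel. ((\<lambda>t. half_kernel \<sigma> u * h (X t + u)) \<longlongrightarrow> half_kernel \<sigma> u * l) at_top"
      by (intro AE_I2 tendsto_mult tendsto_const lim)
  qed measurable
  thus ?thesis
    using half_kernel_integral[OF assms(1)] by (simp add: right_average_def)
qed

lemma right_average_limit_at_top:
  assumes "\<sigma> > 0" and "continuous_on UNIV h" and "\<And>x. \<bar>h x\<bar> \<le> b"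
    and lim: "(h \<longlongrightarrow> l) at_top"
  shows "(right_average \<sigma> h \<longlongrightarrow> l) at_top"
proof -
  have "((\<lambda>t. h (t + u)) \<longlongrightarrow> l) at_top" for u
  proof (rule filterlim_compose[OF lim])
    show "filterlim (\<lambda>t. t + u) at_top at_top"
      unfolding add.commute[of _ u] by (rule filterlim_tendsto_add_at_top[OF tendsto_const filterlim_ident])
  qed
  thus ?thesis by (rule right_average_tendsto_along[OF assms(1-3), where X = "\<lambda>t. t"])
qed

lemma right_average_limit_at_bot:
  assumes "\<sigma> > 0" and "continuous_on UNIV h" and "\<And>x. \<bar>h x\<bar> \<le> b"
    and lim: "(h \<longlongrightarrow> l) at_bot"
  shows "(right_average \<sigma> h \<longlongrightarrow> l) at_bot"
proof -
  have "((\<lambda>t. h (- t + u)) \<longlongrightarrow> l) at_top" for u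
  proof (rule filterlim_compose[OF lim])
    have "filterlim (\<lambda>t::real. - u + t) at_top at_top"
      by (rule filterlim_tendsto_add_at_top[OF tendsto_const filterlim_ident])
    thus "filterlim (\<lambda>t. - t + u) at_bot at_top"
      by (simp add: filterlim_uminus_at_bot)
  qed
  from right_average_tendsto_along[OF assms(1-3) this] show ?thesis
    unfolding filterlim_at_bot_mirror .
qed

text \<open>After the shift \<open>y = x + u\<close> the average is \<open>exp (x/\<sigma>)\<close> times the tail integral over \<open>{x..}\<close> of a
  function that does not depend on \<open>x\<close>, so continuity of \<open>h\<close> is enough to differentiate it.\<close>

lemma right_average_deriv:
  assumes \<sigma>: "\<sigma> > 0" and cont: "continuous_on UNIV h" and bound: "\<And>x. \<bar>h x\<bar> \<le> b"
  shows "(right_average \<sigma> h has_real_derivative (right_average \<sigma> h x - h x) / \<sigma>) (at x)"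
proof -
  define g where "g y = exp (- y / \<sigma>) / \<sigma> * h y" for y
  have cont_g: "continuous_on S g" for S
    unfolding g_def using \<sigma> by (intro continuous_intros continuous_on_subset[OF cont]) auto
  have g_x: "exp (x / \<sigma>) * g x = h x / \<sigma>"
    by (simp add: g_def exp_minus)
  have tail: "right_average \<sigma> h t = exp (t / \<sigma>) * (LINT y:{t..}|lborel. g y)"
    and tail_int: "set_integrable lborel {t..} g" for t
  proof -
    have eq: "half_kernel \<sigma> u * h (t + u) = exp (t / \<sigma>) * (indicator {t..} (t + 1 * u) *\<^sub>R g (t + 1 * u))" for u
      by (auto simp: half_kernel_def g_def indicator_def exp_add[symmetric] add_divide_distrib diff_divide_distrib)
    have "integrable lborel (\<lambda>u. exp (t / \<sigma>) * (indicator {t..} (t + 1 * u) *\<^sub>R g (t + 1 * u)))"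
      using half_kernel_mult_integrable[OF assms, of t] unfolding eq .
    hence "integrable lborel (\<lambda>u. indicator {t..} (t + 1 * u) *\<^sub>R g (t + 1 * u))"
      by simp
    thus "set_integrable lborel {t..} g"
      unfolding set_integrable_def using lborel_integrable_real_affine_iff[of 1 "\<lambda>y. indicator {t..} y *\<^sub>R g y" t]
      by simp
    show "right_average \<sigma> h t = exp (t / \<sigma>) * (LINT y:{t..}|lborel. g y)"
      unfolding right_average_def eq set_lebesgue_integral_def
      using lborel_integral_real_affine[of 1 "\<lambda>y. indicator {t..} y *\<^sub>R g y" t] by simp
  qed
  \<comment> \<open>The tail is cut at a fixed point \<open>x + 1\<close>, so that only a compact integral depends on \<open>t\<close>.\<close>
  have split: "(LINT y:{t..}|lborel. g y) = integral {t..x+1} g + (LINT y:{x+1<..}|lborel. g y)"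
    if "t \<in> {x-1..x+1}" for t
  proof -
    have un: "{t..} = {t..x+1} \<union> {x+1<..}" using that by auto
    have i: "set_integrable lborel {t..x+1} g" "set_integrable lborel {x+1<..} g"
      using that by (auto intro!: set_integrable_subset[OF tail_int[of t]])
    show ?thesis
      unfolding un by (subst set_integral_Un[OF _ i]) (auto simp: set_borel_integral_eq_integral(2)[OF i(1)])
  qed
  have "((\<lambda>t. integral {t..x+1} g) has_real_derivative - g x) (at x within {x-1..x+1})"
    by (rule integral_has_real_derivative'[OF cont_g]) simp
  hence J: "((\<lambda>t. integral {t..x+1} g) has_real_derivative - g x) (at x)"
    by (simp add: at_within_Icc_at)
  have E: "((\<lambda>t. exp (t / \<sigma>)) has_real_derivative exp (x / \<sigma>) / \<sigma>) (at x)"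
    using \<sigma> by (auto intro!: derivative_eq_intros)
  have "((\<lambda>t. exp (t / \<sigma>) * (integral {t..x+1} g + (LINT y:{x+1<..}|lborel. g y)))
      has_real_derivative (right_average \<sigma> h x - h x) / \<sigma>) (at x)"
    by (rule DERIV_cong[OF DERIV_mult[OF E DERIV_add[OF J DERIV_const]]])
      (use g_x in \<open>simp add: tail split diff_divide_distrib mult.commute\<close>)
  moreover have "\<forall>\<^sub>F t in nhds x. exp (t / \<sigma>) * (integral {t..x+1} g + (LINT y:{x+1<..}|lborel. g y)) = right_average \<sigma> h t"
  proof -
    have "\<forall>\<^sub>F t in nhds x. t \<in> {x-1<..<x+1}" by (intro eventually_nhds_in_open) auto
    thus ?thesis by eventually_elim (simp add: tail split)
  qed
  ultimately show ?thesis by (rule DERIV_cong_ev[OF refl _ refl, THEN iffD1, rotated])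
qed

text \<open>The left average is the right average of the reflected function, at the reflected point. The two
  halves of the kernel overlap at \<open>0\<close>, which is a null set.\<close>

lemma convolution_synaptic_kernel:
  assumes \<sigma>: "\<sigma> > 0" and cont: "continuous_on UNIV h" and bound: "\<And>x. \<bar>h x\<bar> \<le> b"
  shows "convolution (synaptic_kernel \<sigma>) h x =
    (right_average \<sigma> h x + right_average \<sigma> (\<lambda>y. h (- y)) (- x)) / 2"
proof -
  have [measurable]: "h \<in> borel_measurable borel"
    using cont by (rule borel_measurable_continuous_onI)
  have cont': "continuous_on UNIV (\<lambda>y. h (- y))"
    by (intro continuous_on_compose2[OF cont]) (auto intro: continuous_intros)
  have i1: "integrable lborel (\<lambda>u. half_kernel \<sigma> u * h (x + u))"
    by (rule half_kernel_mult_integrable[OF assms])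
  have "integrable lborel (\<lambda>u. half_kernel \<sigma> u * h (x - u))"
    using half_kernel_mult_integrable[OF \<sigma> cont' bound, of "-x"] by simp
  from lborel_integrable_real_affine[OF this, of "-1" 0]
  have i2: "integrable lborel (\<lambda>u. half_kernel \<sigma> (- u) * h (x + u))" by simp
  have "convolution (synaptic_kernel \<sigma>) h x = (\<integral>u. synaptic_kernel \<sigma> u * h (x + u) \<partial>lborel)"
    unfolding convolution_def
    using lborel_integral_real_affine[of 1 "\<lambda>y. synaptic_kernel \<sigma> (x - y) * h y" x]
    by (simp add: synaptic_kernel_def)
  also have "\<dots> = (\<integral>u. (half_kernel \<sigma> u * h (x + u) + half_kernel \<sigma> (- u) * h (x + u)) / 2 \<partial>lborel)"
  proof (rule integral_cong_AE)
    show "AE u in lborel. synaptic_kernel \<sigma> u * h (x + u)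
      = (half_kernel \<sigma> u * h (x + u) + half_kernel \<sigma> (- u) * h (x + u)) / 2"
      using AE_lborel_singleton[of "0::real"]
      by eventually_elim (auto simp: synaptic_kernel_def half_kernel_def indicator_def abs_if)
  qed (simp_all add: synaptic_kernel_def)
  also have "\<dots> = (right_average \<sigma> h x + (\<integral>u. half_kernel \<sigma> (- u) * h (x + u) \<partial>lborel)) / 2"
    using i1 i2 by (simp add: right_average_def)
  also have "(\<integral>u. half_kernel \<sigma> (- u) * h (x + u) \<partial>lborel) = right_average \<sigma> (\<lambda>y. h (- y)) (- x)"
    using lborel_integral_real_affine[of "-1" "\<lambda>u. half_kernel \<sigma> (- u) * h (x + u)" 0]
    by (simp add: right_average_def)
  finally show ?thesis .
qed

text \<open>With right average \<open>R\<close> and left average \<open>L\<close>, the equations \<open>\<sigma> R' = R - h\<close> and \<open>\<sigma> L' = h - L\<close> give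
  \<open>s = (R + L)/2\<close> the derivative \<open>(R - L)/(2 \<sigma>)\<close>, which is differentiable again although \<open>h\<close> is only
  continuous, and tends to \<open>0\<close> because \<open>R\<close> and \<open>L\<close> have the same limits.\<close>

lemma convolution_synaptic_kernel_solves_ODE:
  assumes \<sigma>: "\<sigma> > 0" and cont: "continuous_on UNIV h" and bound: "\<And>x. \<bar>h x\<bar> \<le> b"
    and bot: "(h \<longlongrightarrow> l1) at_bot" and top: "(h \<longlongrightarrow> l2) at_top"
  defines "s \<equiv> convolution (synaptic_kernel \<sigma>) h"
  obtains s' where
    "\<And>x. (s has_real_derivative s' x) (at x)"
    "\<And>x. (s' has_real_derivative (s x - h x) / \<sigma>\<^sup>2) (at x)"
    "(s \<longlongrightarrow> l1) at_bot" "(s \<longlongrightarrow> l2) at_top" "(s' \<longlongrightarrow> 0) at_bot" "(s' \<longlongrightarrow> 0) at_top"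
proof
  define R where "R = right_average \<sigma> h"
  define L where "L x = right_average \<sigma> (\<lambda>y. h (- y)) (- x)" for x
  have cont': "continuous_on UNIV (\<lambda>y. h (- y))"
    by (intro continuous_on_compose2[OF cont]) (auto intro: continuous_intros)
  have s: "s = (\<lambda>x. (R x + L x) / 2)"
    unfolding s_def R_def L_def by (rule ext) (rule convolution_synaptic_kernel[OF \<sigma> cont bound])
  have R': "(R has_real_derivative (R x - h x) / \<sigma>) (at x)" for x
    unfolding R_def by (rule right_average_deriv[OF \<sigma> cont bound])
  have L': "(L has_real_derivative (h x - L x) / \<sigma>) (at x)" for x
  proof -
    have "((\<lambda>x. right_average \<sigma> (\<lambda>y. h (- y)) (- x)) has_real_derivative
        (right_average \<sigma> (\<lambda>y. h (- y)) (- x) - h (- (- x))) / \<sigma> * (- 1)) (at x)"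
      by (rule DERIV_chain2[OF right_average_deriv[OF \<sigma> cont' bound]]) (auto intro!: derivative_eq_intros)
    thus ?thesis using \<sigma> by (simp add: L_def[abs_def] field_simps)
  qed
  have Rt: "(R \<longlongrightarrow> l2) at_top" "(R \<longlongrightarrow> l1) at_bot"
    unfolding R_def using right_average_limit_at_top[OF \<sigma> cont bound top]
      right_average_limit_at_bot[OF \<sigma> cont bound bot] by auto
  have "((\<lambda>y. h (- y)) \<longlongrightarrow> l1) at_top" "((\<lambda>y. h (- y)) \<longlongrightarrow> l2) at_bot"
    using bot[unfolded filterlim_at_bot_mirror] top[unfolded filterlim_at_top_mirror] by auto
  hence "(right_average \<sigma> (\<lambda>y. h (- y)) \<longlongrightarrow> l1) at_top" "(right_average \<sigma> (\<lambda>y. h (- y)) \<longlongrightarrow> l2) at_bot"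
    using right_average_limit_at_top[OF \<sigma> cont' bound] right_average_limit_at_bot[OF \<sigma> cont' bound] by auto
  hence Lt: "(L \<longlongrightarrow> l2) at_top" "(L \<longlongrightarrow> l1) at_bot"
    unfolding filterlim_at_top_mirror[of L] filterlim_at_bot_mirror[of L] L_def minus_minus
    by auto
  define s' where "s' x = (R x - L x) / (2 * \<sigma>)" for x
  show "(s has_real_derivative s' x) (at x)" for x
    unfolding s s'_def using \<sigma> by (auto intro!: derivative_eq_intros R' L' simp: field_simps)
  show "(s' has_real_derivative (s x - h x) / \<sigma>\<^sup>2) (at x)" for x
    unfolding s s'_def using \<sigma>
    by (auto intro!: derivative_eq_intros R' L' simp: field_simps power2_eq_square)
  show "(s \<longlongrightarrow> l1) at_bot" "(s \<longlongrightarrow> l2) at_top"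
    unfolding s using tendsto_divide[OF tendsto_add[OF Rt(2) Lt(2)] tendsto_const[of 2]]
      tendsto_divide[OF tendsto_add[OF Rt(1) Lt(1)] tendsto_const[of 2]] by simp_all
  show "(s' \<longlongrightarrow> 0) at_bot" "(s' \<longlongrightarrow> 0) at_top"
    unfolding s'_def using \<sigma> tendsto_divide[OF tendsto_diff[OF Rt(2) Lt(2)] tendsto_const[of "2*\<sigma>"]]
      tendsto_divide[OF tendsto_diff[OF Rt(1) Lt(1)] tendsto_const[of "2*\<sigma>"]] by simp_all
qed

section \<open>The potential\<close>

text \<open>\<open>F u - u\<close> has no zero strictly between consecutive fixed points, so by the intermediate value
  theorem its sign there is the one next to \<open>a\<close>, which is determined by \<open>F' a > 1\<close>.\<close>

lemma bistable_sign:
  assumes diff: "\<And>x. (F has_real_derivative F' x) (at x)" and bi: "bistable F a1 a a2"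
  shows "a1 < y \<Longrightarrow> y < a \<Longrightarrow> F y < y" and "a < y \<Longrightarrow> y < a2 \<Longrightarrow> y < F y"
proof -
  define g where "g x = F x - x" for x
  have zeros: "g x = 0 \<longleftrightarrow> x \<in> {a1, a, a2}" for x
    using bi unfolding bistable_def g_def by blast
  have ord: "a1 < a" "a < a2" using bi unfolding bistable_def by blast+
  have cont: "continuous_on S g" for S
    unfolding g_def
    by (intro continuous_intros continuous_at_imp_continuous_on ballI DERIV_isCont[OF diff])
  have "deriv F a = F' a" by (rule DERIV_imp_deriv[OF diff])
  hence "F' a - 1 > 0" using bi unfolding bistable_def by linarith
  moreover have "(g has_real_derivative F' a - 1) (at a)"
    unfolding g_def by (auto intro!: derivative_eq_intros diff)
  ultimately have "\<exists>d>0. \<forall>k>0. k < d \<longrightarrow> g (a - k) < g a" "\<exists>d>0. \<forall>k>0. k < d \<longrightarrow> g a < g (a + k)"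
    by (auto intro: DERIV_pos_inc_left DERIV_pos_inc_right)
  then obtain d1 d2 where d: "d1 > 0" "\<And>k. 0 < k \<Longrightarrow> k < d1 \<Longrightarrow> g (a - k) < g a"
      "d2 > 0" "\<And>k. 0 < k \<Longrightarrow> k < d2 \<Longrightarrow> g a < g (a + k)"
    by blast
  have ga: "g a = 0" using zeros by simp
  {
    assume y: "a1 < y" "y < a"
    define k where "k = min (d1 / 2) (a - y)"
    have k: "0 < k" "k < d1" "k \<le> a - y" using d y by (auto simp: k_def min_def)
    have neg: "g (a - k) < 0" using d(2)[OF k(1,2)] ga by simp
    show "F y < y"
    proof (rule ccontr)
      assume "\<not> F y < y"
      hence "g y \<ge> 0" by (simp add: g_def)
      then obtain x where "y \<le> x" "x \<le> a - k" "g x = 0"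
        using IVT2'[of g "a - k" 0 y] neg k cont by auto
      thus False using zeros[of x] y k ord by auto
    qed
  }
  {
    assume y: "a < y" "y < a2"
    define k where "k = min (d2 / 2) (y - a)"
    have k: "0 < k" "k < d2" "k \<le> y - a" using d y by (auto simp: k_def min_def)
    have pos: "g (a + k) > 0" using d(4)[OF k(1,2)] ga by simp
    show "y < F y"
    proof (rule ccontr)
      assume "\<not> y < F y"
      hence "g y \<le> 0" by (simp add: g_def)
      then obtain x where "a + k \<le> x" "x \<le> y" "g x = 0"
        using IVT2'[of g y 0 "a + k"] pos k cont by auto
      thus False using zeros[of x] y k ord by auto
    qed
  }
qed

lemma bistable_potential:
  assumes diff: "\<And>x. (F has_real_derivative F' x) (at x)" and bi: "bistable F a1 a a2"
  obtains \<Phi> where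
    "\<And>u. u \<in> {a1..a2} \<Longrightarrow> (\<Phi> has_real_derivative u - F u) (at u)"
    "\<And>u. u \<in> {a1..a2} \<Longrightarrow> \<Phi> u \<le> \<Phi> a"
    "\<Phi> a1 < \<Phi> a" "\<Phi> a2 < \<Phi> a"
    "integral {a1..a2} (\<lambda>x. x - F x) = \<Phi> a2 - \<Phi> a1"
    "integral {a1..a} (\<lambda>x. x - F x) = \<Phi> a - \<Phi> a1"
    "integral {a..a2} (\<lambda>x. F x - x) = \<Phi> a - \<Phi> a2"
proof -
  have ord: "a1 < a" "a < a2" using bi unfolding bistable_def by blast+
  \<comment> \<open>The margin makes the derivative of the primitive two-sided at \<open>a1\<close> and \<open>a2\<close>.\<close>
  have "continuous_on {a1-1..a2+1} (\<lambda>x. x - F x)"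
    by (intro continuous_intros continuous_at_imp_continuous_on ballI DERIV_isCont[OF diff])
  from antiderivative_continuous[OF this] obtain \<Phi> where \<Phi>: "\<And>u. u \<in> {a1-1..a2+1} \<Longrightarrow>
      (\<Phi> has_vector_derivative u - F u) (at u within {a1-1..a2+1})"
    by metis
  have D: "(\<Phi> has_real_derivative u - F u) (at u)" if "u \<in> {a1..a2}" for u
    using \<Phi>[of u] that at_within_Icc_at[of "a1-1" u "a2+1"]
    by (simp add: has_real_derivative_iff_has_vector_derivative)
  have up: "\<Phi> u < \<Phi> w" if "a1 \<le> u" "u < w" "w \<le> a" for u w
  proof (rule DERIV_pos_imp_increasing_open[OF that(2)])
    show "\<exists>y. (\<Phi> has_real_derivative y) (at x) \<and> 0 < y" if "u < x" "x < w" for x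
    proof (intro exI conjI)
      show "(\<Phi> has_real_derivative x - F x) (at x)"
        by (rule D) (use that \<open>a1 \<le> u\<close> \<open>w \<le> a\<close> ord in simp)
      show "0 < x - F x"
        using bistable_sign(1)[OF diff bi, of x] that \<open>a1 \<le> u\<close> \<open>w \<le> a\<close> by linarith
    qed
    show "continuous_on {u..w} \<Phi>"
      using that ord by (intro continuous_at_imp_continuous_on ballI DERIV_isCont[OF D]) auto
  qed
  have down: "\<Phi> w < \<Phi> u" if "a \<le> u" "u < w" "w \<le> a2" for u w
  proof (rule DERIV_neg_imp_decreasing_open[OF that(2)])
    show "\<exists>y. (\<Phi> has_real_derivative y) (at x) \<and> y < 0" if "u < x" "x < w" for x
    proof (intro exI conjI)
      show "(\<Phi> has_real_derivative x - F x) (at x)"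
        by (rule D) (use that \<open>a \<le> u\<close> \<open>w \<le> a2\<close> ord in simp)
      show "x - F x < 0"
        using bistable_sign(2)[OF diff bi, of x] that \<open>a \<le> u\<close> \<open>w \<le> a2\<close> by linarith
    qed
    show "continuous_on {u..w} \<Phi>"
      using that ord by (intro continuous_at_imp_continuous_on ballI DERIV_isCont[OF D]) auto
  qed
  have ftc: "((\<lambda>x. x - F x) has_integral \<Phi> w - \<Phi> u) {u..w}" if "a1 \<le> u" "u \<le> w" "w \<le> a2" for u w
  proof (rule fundamental_theorem_of_calculus[OF that(2)])
    show "(\<Phi> has_vector_derivative x - F x) (at x within {u..w})" if "x \<in> {u..w}" for x
      using D[of x] that \<open>a1 \<le> u\<close> \<open>w \<le> a2\<close>
      by (auto simp: has_real_derivative_iff_has_vector_derivative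
          intro: has_vector_derivative_at_within)
  qed
  show ?thesis
  proof
    show "\<Phi> u \<le> \<Phi> a" if "u \<in> {a1..a2}" for u
      using up[of u a] down[of a u] that ord by (cases u a rule: linorder_cases) auto
    show "\<Phi> a1 < \<Phi> a" "\<Phi> a2 < \<Phi> a" using up[of a1 a] down[of a a2] ord by auto
    show "integral {a1..a2} (\<lambda>x. x - F x) = \<Phi> a2 - \<Phi> a1"
      "integral {a1..a} (\<lambda>x. x - F x) = \<Phi> a - \<Phi> a1"
      using ftc ord by (auto intro!: integral_unique)
    have "((\<lambda>x. - (x - F x)) has_integral - (\<Phi> a2 - \<Phi> a)) {a..a2}"
      by (rule has_integral_neg) (use ftc ord in auto)
    thus "integral {a..a2} (\<lambda>x. F x - x) = \<Phi> a - \<Phi> a2"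
      by (auto dest: integral_unique)
  qed (use D in auto)
qed

section \<open>Energy estimates along the profile\<close>

text \<open>The differential form of the wave equation for positive speed. The convolution has been
  eliminated, and \<open>\<Phi>\<close> is any primitive of \<open>u - F u\<close>, since only its differences matter.\<close>

locale advancing_profile =
  fixes \<sigma> c a1 a2 :: real and F F' \<Phi> v v1 v2 v3 :: "real \<Rightarrow> real"
  assumes \<sigma>: "\<sigma> > 0" and c: "c > 0"
    and F_deriv: "\<And>u. (F has_real_derivative F' u) (at u)"
    and F'_nonneg: "\<And>u. F' u \<ge> 0"
    and fixed: "F a1 = a1" "F a2 = a2"
    and \<Phi>_deriv: "\<And>u. u \<in> {a1..a2} \<Longrightarrow> (\<Phi> has_real_derivative u - F u) (at u)"
    and v_deriv: "\<And>x. (v has_real_derivative v1 x) (at x)"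
    and v1_deriv: "\<And>x. (v1 has_real_derivative v2 x) (at x)"
    and v2_deriv: "\<And>x. (v2 has_real_derivative v3 x) (at x)"
    and v1_pos: "\<And>x. v1 x > 0"
    and profile: "\<And>x. (v x - \<sigma>\<^sup>2 * v2 x) - c * (v1 x - \<sigma>\<^sup>2 * v3 x) = F (v x)"
    and v_lim: "(v \<longlongrightarrow> a1) at_bot" "(v \<longlongrightarrow> a2) at_top"
    and v1_lim: "(v1 \<longlongrightarrow> 0) at_bot" "(v1 \<longlongrightarrow> 0) at_top"
    and v2_lim: "(v2 \<longlongrightarrow> 0) at_bot" "(v2 \<longlongrightarrow> 0) at_top"
begin

text \<open>The function \<open>p\<close> of the introduction: its convolution with the kernel gives back \<open>v\<close>.\<close>

definition source where "source x = v x - \<sigma>\<^sup>2 * v2 x"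

text \<open>The energy of a particle at position \<open>v\<close>, with potential \<open>\<Phi>\<close> and kinetic part of negative sign.
  It is conserved for \<open>c = 0\<close>.\<close>

definition mech_energy where "mech_energy x = \<Phi> (v x) - \<sigma>\<^sup>2 * (v1 x)\<^sup>2 / 2"

lemma v_range: "v x \<in> {a1..a2}"
  using le_limit_at_top[OF v_deriv less_imp_le[OF v1_pos] v_lim(2)]
    limit_at_bot_le[OF v_deriv less_imp_le[OF v1_pos] v_lim(1)] by auto

lemma source_deriv: "(source has_real_derivative v1 x - \<sigma>\<^sup>2 * v3 x) (at x)"
  unfolding source_def by (auto intro!: derivative_eq_intros v_deriv v2_deriv)

lemma source_lim: "(source \<longlongrightarrow> a1) at_bot" "(source \<longlongrightarrow> a2) at_top"
  unfolding source_def
  using tendsto_diff[OF v_lim(1) tendsto_mult[OF tendsto_const v2_lim(1)], of "\<sigma>\<^sup>2"]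
    tendsto_diff[OF v_lim(2) tendsto_mult[OF tendsto_const v2_lim(2)], of "\<sigma>\<^sup>2"] by simp_all

text \<open>The equation \<open>p - c p' = F(v)\<close> says that \<open>p\<close> averages \<open>F(v)\<close> over \<open>{x..}\<close> with weight
  \<open>exp ((x - y)/c)/c\<close>, and \<open>F(v)\<close> is increasing. The integral is avoided by showing that
  \<open>exp (- x/c) (F(v) - p)\<close> is nondecreasing with limit \<open>0\<close> at infinity.\<close>

lemma source_ge: "F (v x) \<le> source x"
proof -
  define g where "g t = exp (- t / c) * (F (v t) - source t)" for t
  have Fv: "((\<lambda>t. F (v t)) has_real_derivative F' (v t) * v1 t) (at t)" for t
    by (rule DERIV_chain2[OF F_deriv v_deriv])
  have "(g has_real_derivative exp (- t / c) * (F' (v t) * v1 t)) (at t)" for t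
  proof -
    have "(g has_real_derivative - exp (- t / c) / c * (F (v t) - source t)
        + exp (- t / c) * (F' (v t) * v1 t - (v1 t - \<sigma>\<^sup>2 * v3 t))) (at t)"
      unfolding g_def using c by (auto intro!: derivative_eq_intros Fv source_deriv)
    moreover have "F (v t) - source t = - c * (v1 t - \<sigma>\<^sup>2 * v3 t)"
      using profile[of t] by (simp add: source_def)
    ultimately show ?thesis using c by (simp add: algebra_simps)
  qed
  moreover have "exp (- t / c) * (F' (v t) * v1 t) \<ge> 0" for t
    using F'_nonneg v1_pos by (simp add: less_imp_le)
  moreover have "(g \<longlongrightarrow> 0) at_top"
  proof -
    have "((\<lambda>t. F (v t)) \<longlongrightarrow> F a2) at_top"
      by (rule isCont_tendsto_compose[OF DERIV_isCont[OF F_deriv] v_lim(2)])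
    hence diff: "((\<lambda>t. F (v t) - source t) \<longlongrightarrow> 0) at_top"
      using tendsto_diff[OF _ source_lim(2)] fixed by fastforce
    from tendsto_mult[OF exp_minus_divide_tendsto_0[OF c] diff] show ?thesis by (simp add: g_def[abs_def])
  qed
  ultimately have "g x \<le> 0" by (rule le_limit_at_top)
  thus ?thesis by (simp add: g_def mult_le_0_iff)
qed

lemma source_deriv_nonneg: "v1 x - \<sigma>\<^sup>2 * v3 x \<ge> 0"
proof -
  have "c * (v1 x - \<sigma>\<^sup>2 * v3 x) \<ge> 0"
    using source_ge[of x] profile[of x] by (simp add: source_def)
  thus ?thesis using c by (simp add: zero_le_mult_iff)
qed

text \<open>Multiply \<open>v - F(v) = \<sigma>\<^sup>2 v'' + c p'\<close> by \<open>v'\<close>.\<close>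

lemma mech_energy_deriv: "(mech_energy has_real_derivative c * v1 x * (v1 x - \<sigma>\<^sup>2 * v3 x)) (at x)"
proof -
  have "(mech_energy has_real_derivative (v x - F (v x)) * v1 x - \<sigma>\<^sup>2 * v1 x * v2 x) (at x)"
    unfolding mech_energy_def
    by (auto intro!: derivative_eq_intros v1_deriv DERIV_chain2[OF \<Phi>_deriv[OF v_range] v_deriv])
  moreover have "(v x - F (v x)) * v1 x - \<sigma>\<^sup>2 * v1 x * v2 x = c * v1 x * (v1 x - \<sigma>\<^sup>2 * v3 x)"
    unfolding profile[of x, symmetric] by (simp add: algebra_simps)
  ultimately show ?thesis by simp
qed

lemma mech_energy_lim: "(mech_energy \<longlongrightarrow> \<Phi> a1) at_bot" "(mech_energy \<longlongrightarrow> \<Phi> a2) at_top"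
proof -
  have le: "a1 \<le> a2" using v_range[of 0] by simp
  have "((\<lambda>x. \<Phi> (v x)) \<longlongrightarrow> \<Phi> a1) at_bot" "((\<lambda>x. \<Phi> (v x)) \<longlongrightarrow> \<Phi> a2) at_top"
    using le by (auto intro!: isCont_tendsto_compose[OF DERIV_isCont[OF \<Phi>_deriv]] v_lim)
  thus "(mech_energy \<longlongrightarrow> \<Phi> a1) at_bot" "(mech_energy \<longlongrightarrow> \<Phi> a2) at_top"
    unfolding mech_energy_def using v1_lim by (auto intro!: tendsto_eq_intros)
qed

lemma mech_energy_bounds: "\<Phi> a1 \<le> mech_energy x" "mech_energy x \<le> \<Phi> a2"
proof -
  have nonneg: "c * v1 x * (v1 x - \<sigma>\<^sup>2 * v3 x) \<ge> 0" for x
    using c source_deriv_nonneg[of x] v1_pos[of x] by simp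
  show "\<Phi> a1 \<le> mech_energy x" by (rule limit_at_bot_le[OF mech_energy_deriv nonneg mech_energy_lim(1)])
  show "mech_energy x \<le> \<Phi> a2" by (rule le_limit_at_top[OF mech_energy_deriv nonneg mech_energy_lim(2)])
qed

text \<open>The energy grows at rate \<open>c v' p' \<le> c M p'\<close>, and \<open>p\<close> grows by \<open>a2 - a1\<close> in total.\<close>

lemma energy_gap_le_max_slope:
  assumes M: "\<And>x. v1 x \<le> M"
  shows "\<Phi> a2 - \<Phi> a1 \<le> c * M * (a2 - a1)"
proof -
  define g where "g x = c * M * source x - mech_energy x" for x
  have D: "(g has_real_derivative c * (M - v1 x) * (v1 x - \<sigma>\<^sup>2 * v3 x)) (at x)" for x
  proof -
    have "(g has_real_derivative c * M * (v1 x - \<sigma>\<^sup>2 * v3 x) - c * v1 x * (v1 x - \<sigma>\<^sup>2 * v3 x)) (at x)"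
      unfolding g_def by (auto intro!: derivative_eq_intros source_deriv mech_energy_deriv)
    thus ?thesis by (simp add: algebra_simps)
  qed
  have nonneg: "c * (M - v1 x) * (v1 x - \<sigma>\<^sup>2 * v3 x) \<ge> 0" for x
    using c source_deriv_nonneg[of x] M[of x] by simp
  have "(g \<longlongrightarrow> c * M * a1 - \<Phi> a1) at_bot" "(g \<longlongrightarrow> c * M * a2 - \<Phi> a2) at_top"
    unfolding g_def by (auto intro!: tendsto_intros source_lim mech_energy_lim)
  from order_trans[OF limit_at_bot_le[OF D nonneg this(1), of 0] le_limit_at_top[OF D nonneg this(2), of 0]]
  show ?thesis by (simp add: algebra_simps)
qed

text \<open>Up to the derivative of \<open>- \<sigma>\<^sup>2 v' v''\<close>, which vanishes at both ends, \<open>v' p'\<close> equals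
  \<open>v'\<^sup>2 + \<sigma>\<^sup>2 v''\<^sup>2\<close>. Completing the square, this dominates both \<open>\<sigma> (v'\<^sup>2)'\<close> and \<open>- \<sigma> (v'\<^sup>2)'\<close>. The
  first is used to the left of \<open>x\<close> and the second to the right of it, and each contributes
  \<open>\<sigma> v'(x)\<^sup>2\<close>.\<close>

lemma energy_gap_ge_slope_squared: "2 * c * \<sigma> * (v1 x)\<^sup>2 \<le> \<Phi> a2 - \<Phi> a1"
proof -
  define Q where "Q x = mech_energy x + c * \<sigma>\<^sup>2 * (v1 x * v2 x)" for x
  \<comment> \<open>The sign \<open>e\<close> is \<open>-1\<close> for the left half-line and \<open>1\<close> for the right one.\<close>
  have D: "((\<lambda>x. Q x + e * c * \<sigma> * (v1 x)\<^sup>2) has_real_derivative c * (v1 x + e * \<sigma> * v2 x)\<^sup>2) (at x)"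
    if e: "e\<^sup>2 = 1" for e x
  proof -
    have "((\<lambda>x. Q x + e * c * \<sigma> * (v1 x)\<^sup>2) has_real_derivative
       c * v1 x * (v1 x - \<sigma>\<^sup>2 * v3 x) + c * \<sigma>\<^sup>2 * (v2 x * v2 x + v3 x * v1 x)
         + e * c * \<sigma> * (2 * v1 x * v2 x)) (at x)"
      unfolding Q_def by (auto intro!: derivative_eq_intros mech_energy_deriv v1_deriv v2_deriv)
    moreover have "c * v1 x * (v1 x - \<sigma>\<^sup>2 * v3 x) + c * \<sigma>\<^sup>2 * (v2 x * v2 x + v3 x * v1 x)
         + e * c * \<sigma> * (2 * v1 x * v2 x) = c * (v1 x + e * \<sigma> * v2 x)\<^sup>2"
      using e by algebra
    ultimately show ?thesis by simp
  qed
  have lim: "((\<lambda>x. Q x + e * c * \<sigma> * (v1 x)\<^sup>2) \<longlongrightarrow> \<Phi> a1) at_bot"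
    "((\<lambda>x. Q x + e * c * \<sigma> * (v1 x)\<^sup>2) \<longlongrightarrow> \<Phi> a2) at_top" for e
    unfolding Q_def using mech_energy_lim v1_lim v2_lim by (auto intro!: tendsto_eq_intros)
  have "\<Phi> a1 \<le> Q x + (- 1) * c * \<sigma> * (v1 x)\<^sup>2"
    by (rule limit_at_bot_le[OF D _ lim(1)]) (use c in auto)
  moreover have "Q x + 1 * c * \<sigma> * (v1 x)\<^sup>2 \<le> \<Phi> a2"
    by (rule le_limit_at_top[OF D _ lim(2)]) (use c in auto)
  ultimately show ?thesis by simp
qed

text \<open>Since the energy never drops below \<open>\<Phi> a1\<close>, the kinetic part is at most the height of the
  potential barrier above \<open>\<Phi> a1\<close>, which bounds the slope.\<close>

lemma speed_lower_bound:
  assumes max: "\<And>u. u \<in> {a1..a2} \<Longrightarrow> \<Phi> u \<le> m" and pos: "\<Phi> a1 < m" and le: "a1 < a2"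
  shows "\<sigma> / (sqrt 2 * (a2 - a1)) * ((\<Phi> a2 - \<Phi> a1) / sqrt (m - \<Phi> a1)) \<le> c"
proof -
  define M where "M = sqrt 2 * sqrt (m - \<Phi> a1) / \<sigma>"
  have "v1 x \<le> M" for x
  proof -
    have "\<sigma>\<^sup>2 * (v1 x)\<^sup>2 \<le> 2 * (m - \<Phi> a1)"
      using mech_energy_bounds(1)[of x] max[OF v_range, of x] by (simp add: mech_energy_def)
    hence "\<sigma> * v1 x \<le> sqrt (2 * (m - \<Phi> a1))"
      by (intro real_le_rsqrt) (simp add: power_mult_distrib)
    thus ?thesis using \<sigma> by (simp add: M_def real_sqrt_mult[symmetric] field_simps)
  qed
  from energy_gap_le_max_slope[OF this] show ?thesis
    using \<sigma> pos le by (simp add: M_def field_simps)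
qed

text \<open>Since the energy never exceeds \<open>\<Phi> a2\<close>, the profile must cross the top of the barrier, \<open>v = a\<close>,
  with a kinetic part of at least \<open>\<Phi> a - \<Phi> a2\<close>.\<close>

lemma speed_upper_bound:
  assumes a: "a1 < a" "a < a2" and less: "\<Phi> a2 < \<Phi> a"
  shows "c \<le> \<sigma> / 4 * ((\<Phi> a2 - \<Phi> a1) / (\<Phi> a - \<Phi> a2))"
proof -
  obtain x where x: "v x = a"
  proof -
    obtain l where l: "v l < a"
      using eventually_happens[OF order_tendstoD(2)[OF v_lim(1) a(1)]] by auto
    obtain r where r: "v r > a"
      using eventually_happens[OF order_tendstoD(1)[OF v_lim(2) a(2)]] by auto
    have "l \<le> r"
    proof (rule ccontr)
      assume "\<not> l \<le> r"
      hence "v r \<le> v l"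
        using v_deriv v1_pos by (intro DERIV_nonneg_imp_nondecreasing[of r l v]) (auto intro: less_imp_le)
      thus False using l r by simp
    qed
    moreover have "continuous_on {l..r} v"
      by (intro continuous_at_imp_continuous_on ballI DERIV_isCont[OF v_deriv])
    ultimately obtain y where "v y = a"
      using IVT'[of v l a r] l r by auto
    thus ?thesis by (rule that)
  qed
  have "\<Phi> a - \<Phi> a2 \<le> \<sigma>\<^sup>2 * (v1 x)\<^sup>2 / 2"
    using mech_energy_bounds(2)[of x] by (simp add: mech_energy_def x)
  hence "4 * c * (\<Phi> a - \<Phi> a2) \<le> 4 * c * (\<sigma>\<^sup>2 * (v1 x)\<^sup>2 / 2)"
    using c by (intro mult_left_mono) auto
  also have "\<dots> = \<sigma> * (2 * c * \<sigma> * (v1 x)\<^sup>2)" by (simp add: power2_eq_square)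
  also have "\<dots> \<le> \<sigma> * (\<Phi> a2 - \<Phi> a1)"
    using \<sigma> by (intro mult_left_mono energy_gap_ge_slope_squared) auto
  finally show ?thesis using less by (simp add: field_simps)
qed

end

text \<open>The case of speed zero, where \<open>v\<close> itself is the convolution and the mechanical energy is constant.\<close>

lemma standing_profile_energy_gap:
  fixes v v1 :: "real \<Rightarrow> real"
  assumes "\<sigma> > 0" and le: "a1 \<le> a2"
    and \<Phi>_deriv: "\<And>u. u \<in> {a1..a2} \<Longrightarrow> (\<Phi> has_real_derivative u - F u) (at u)"
    and v_deriv: "\<And>x. (v has_real_derivative v1 x) (at x)"
    and v1_deriv: "\<And>x. (v1 has_real_derivative (v x - F (v x)) / \<sigma>\<^sup>2) (at x)"
    and range: "\<And>x. v x \<in> {a1..a2}"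
    and v_lim: "(v \<longlongrightarrow> a1) at_bot" "(v \<longlongrightarrow> a2) at_top"
    and v1_lim: "(v1 \<longlongrightarrow> 0) at_bot" "(v1 \<longlongrightarrow> 0) at_top"
  shows "\<Phi> a2 = \<Phi> a1"
proof -
  define N where "N x = \<Phi> (v x) - \<sigma>\<^sup>2 * (v1 x)\<^sup>2 / 2" for x
  have "(N has_real_derivative 0) (at x)" for x
    unfolding N_def using \<open>\<sigma> > 0\<close>
    by (auto intro!: derivative_eq_intros v1_deriv DERIV_chain2[OF \<Phi>_deriv[OF range] v_deriv])
  hence const: "N = (\<lambda>x. N 0)"
    using DERIV_isconst_all by blast
  have "((\<lambda>x. \<Phi> (v x)) \<longlongrightarrow> \<Phi> a1) at_bot" "((\<lambda>x. \<Phi> (v x)) \<longlongrightarrow> \<Phi> a2) at_top"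
    using le by (auto intro!: isCont_tendsto_compose[OF DERIV_isCont[OF \<Phi>_deriv]] v_lim)
  hence "(N \<longlongrightarrow> \<Phi> a1) at_bot" "(N \<longlongrightarrow> \<Phi> a2) at_top"
    unfolding N_def using v1_lim by (auto intro!: tendsto_eq_intros)
  hence "((\<lambda>x::real. N 0) \<longlongrightarrow> \<Phi> a1) at_bot" "((\<lambda>x::real. N 0) \<longlongrightarrow> \<Phi> a2) at_top"
    using const by metis+
  thus ?thesis by (metis tendsto_const tendsto_unique trivial_limit_at_bot_linorder trivial_limit_at_top_linorder)
qed

theorem proposition9:
  fixes \<sigma> a1 a a2 c :: real and F v :: "real \<Rightarrow> real"
  assumes "\<sigma> > 0"
    and "sigmoid F"
    and "bistable F a1 a a2"
    and "monotone_traveling_wave (synaptic_kernel \<sigma>) F a1 a2 v c"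
    and "c \<ge> 0"
    and "convex_concave F"
  shows "\<sigma> / (sqrt 2 * (a2 - a1)) *
           (integral {a1..a2} (\<lambda>x. x - F x) / sqrt (integral {a1..a} (\<lambda>x. x - F x))) \<le> c
       \<and> c \<le> \<sigma> / 4 *
           (integral {a1..a2} (\<lambda>x. x - F x) / integral {a..a2} (\<lambda>x. F x - x))"
proof -
  note \<sigma> = \<open>\<sigma> > 0\<close>
  have F_deriv: "(F has_real_derivative deriv F u) (at u)" for u
    using \<open>sigmoid F\<close> by (simp add: sigmoid_def DERIV_deriv_iff_real_differentiable)
  have F_mono: "strict_mono F" using \<open>sigmoid F\<close> by (simp add: sigmoid_def)
  have F'_nonneg: "deriv F u \<ge> 0" for u
    using F_mono
    by (intro mono_on_imp_deriv_nonneg[OF _ F_deriv, of UNIV])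
      (auto simp: strict_mono_less_eq intro!: mono_onI)
  obtain b where b: "\<And>u. \<bar>F u\<bar> \<le> b"
    using \<open>sigmoid F\<close> by (auto simp: sigmoid_def bounded_iff)
  have ord: "a1 < a" "a < a2" and fixed: "F a1 = a1" "F a2 = a2"
    using \<open>bistable F a1 a a2\<close> unfolding bistable_def by (blast, blast, force+)
  obtain \<Phi> where \<Phi>: "\<And>u. u \<in> {a1..a2} \<Longrightarrow> (\<Phi> has_real_derivative u - F u) (at u)"
    "\<And>u. u \<in> {a1..a2} \<Longrightarrow> \<Phi> u \<le> \<Phi> a" "\<Phi> a1 < \<Phi> a" "\<Phi> a2 < \<Phi> a"
    and int: "integral {a1..a2} (\<lambda>x. x - F x) = \<Phi> a2 - \<Phi> a1"
    "integral {a1..a} (\<lambda>x. x - F x) = \<Phi> a - \<Phi> a1"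
    "integral {a..a2} (\<lambda>x. F x - x) = \<Phi> a - \<Phi> a2"
    using bistable_potential[OF F_deriv \<open>bistable F a1 a a2\<close>] by blast
  define v1 where "v1 = deriv v"
  define s where "s = convolution (synaptic_kernel \<sigma>) (\<lambda>y. F (v y))"
  have v1_pos: "v1 x > 0" and v_lim: "(v \<longlongrightarrow> a1) at_bot" "(v \<longlongrightarrow> a2) at_top"
    and wave: "- c * v1 x = - v x + s x" for x
    using assms(4) by (auto simp: monotone_traveling_wave_def v1_def s_def)
  have v_deriv: "(v has_real_derivative v1 x) (at x)" for x
    using assms(4) by (simp add: monotone_traveling_wave_def v1_def C1_differentiable_on_eq
        DERIV_deriv_iff_real_differentiable)
  have Fv_cont: "continuous_on UNIV (\<lambda>y. F (v y))"
    by (intro continuous_at_imp_continuous_on ballI isCont_o2[OF DERIV_isCont[OF v_deriv]] DERIV_isCont[OF F_deriv])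
  have "((\<lambda>y. F (v y)) \<longlongrightarrow> F a1) at_bot" "((\<lambda>y. F (v y)) \<longlongrightarrow> F a2) at_top"
    by (auto intro!: isCont_tendsto_compose[OF DERIV_isCont[OF F_deriv]] v_lim)
  hence Fv_lim: "((\<lambda>y. F (v y)) \<longlongrightarrow> a1) at_bot" "((\<lambda>y. F (v y)) \<longlongrightarrow> a2) at_top"
    by (simp_all add: fixed)
  obtain s1 where s_deriv: "\<And>x. (s has_real_derivative s1 x) (at x)"
    and s1_deriv: "\<And>x. (s1 has_real_derivative (s x - F (v x)) / \<sigma>\<^sup>2) (at x)"
    and s_lim: "(s \<longlongrightarrow> a1) at_bot" "(s \<longlongrightarrow> a2) at_top"
    and s1_lim: "(s1 \<longlongrightarrow> 0) at_bot" "(s1 \<longlongrightarrow> 0) at_top"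
    using convolution_synaptic_kernel_solves_ODE[OF \<sigma> Fv_cont b Fv_lim] unfolding s_def by metis
  show ?thesis
  proof (cases "c = 0")
    case True
    hence "v = s" using wave by auto
    moreover from this have "v1 = s1" using v_deriv s_deriv DERIV_unique by blast
    moreover have "v x \<in> {a1..a2}" for x
      using le_limit_at_top[OF v_deriv less_imp_le[OF v1_pos] v_lim(2)]
        limit_at_bot_le[OF v_deriv less_imp_le[OF v1_pos] v_lim(1)] by auto
    ultimately have "\<Phi> a2 = \<Phi> a1"
      using ord s_deriv s1_deriv s_lim s1_lim
      by (intro standing_profile_energy_gap[OF \<sigma> _ \<Phi>(1), where v = v and ?v1.0 = v1]) auto
    thus ?thesis using True by (simp add: int)
  next
    case False
    hence c: "c > 0" using \<open>c \<ge> 0\<close> by simp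
    have v1: "v1 = (\<lambda>x. (v x - s x) / c)"
      using wave c by (auto simp: fun_eq_iff field_simps)
    \<comment> \<open>For \<open>c > 0\<close> the wave equation writes \<open>v'\<close> in terms of \<open>v\<close> and \<open>s\<close>, which makes \<open>v\<close> three times
      differentiable and gives the decay of its derivatives.\<close>
    define v2 where "v2 x = (v1 x - s1 x) / c" for x
    define v3 where "v3 x = (v2 x - (s x - F (v x)) / \<sigma>\<^sup>2) / c" for x
    have v1_deriv: "(v1 has_real_derivative v2 x) (at x)" for x
      unfolding v2_def by (subst v1) (intro derivative_intros DERIV_cdivide DERIV_diff v_deriv s_deriv)
    have v2_deriv: "(v2 has_real_derivative v3 x) (at x)" for x
      unfolding v3_def v2_def by (intro DERIV_cdivide DERIV_diff s1_deriv v1_deriv[unfolded v2_def])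
    have v1_lim: "(v1 \<longlongrightarrow> 0) at_bot" "(v1 \<longlongrightarrow> 0) at_top"
      unfolding v1 using c v_lim s_lim by (auto intro!: tendsto_eq_intros)
    have v2_lim: "(v2 \<longlongrightarrow> 0) at_bot" "(v2 \<longlongrightarrow> 0) at_top"
      unfolding v2_def using c v1_lim s1_lim by (auto intro!: tendsto_eq_intros)
    have "(v x - \<sigma>\<^sup>2 * v2 x) - c * (v1 x - \<sigma>\<^sup>2 * v3 x) = F (v x)" for x
      using c \<sigma> wave[of x] by (simp add: v3_def field_simps)
    then interpret advancing_profile \<sigma> c a1 a2 F "deriv F" \<Phi> v v1 v2 v3
      using \<sigma> c F_deriv F'_nonneg fixed \<Phi>(1) v_deriv v1_deriv v2_deriv v1_pos v_lim v1_lim v2_lim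
      by unfold_locales auto
    show ?thesis
      unfolding int using speed_lower_bound[OF \<Phi>(2,3)] speed_upper_bound[OF ord \<Phi>(4)] ord by auto
  qed
qed

end
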